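(* Let $k$ be an algebraically closed field, let $R=k[x_1,\ldots,x_n]$, let $I$ be an ideal of $R$, let $A=R/I$, and let $q\ge1$ be an integer. Then $$\frac{\Phi^{*}_q(I)}{I}=\bigcap_{\mathfrak{n}\in\operatorname{Max}(A)}\mathfrak{n}^q.$$
   Context: For $a=(a_1,\ldots,a_n)\in k^n$, $\mathfrak{m}_a=(x_1-a_1,\ldots,x_n-a_n)\subseteq R$. For every integer $q\ge1$ and every ideal $I$ of $R$, $\Phi^{*}_q(I)=\bigcap_{a\in k^n}(I+\mathfrak{m}_a^q)$. $\operatorname{Max}(A)$ denotes the set of maximal ideals of $A$; an empty intersection of ideals of $A$ is $A$. *)

theory Defs
  imports "HOL-Algebra.Algebra" "HOL-Computational_Algebra.Polynomial" "HOL-Library.Poly_Mapping"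
begin

text \<open>
  Monomials are finitely supported exponent functions, and a polynomial is a finitely supported
  map from monomials to coefficients.  The type has infinitely many variables; the ring in
  \<open>n\<close> variables consists of the polynomials that only involve the variables
  with index \<open>< n\<close>, so \<open>x\<^sub>1, \<dots>, x\<^sub>n\<close> are numbered from \<open>0\<close> here.  The case \<open>n = 0\<close> is allowed.
\<close>

type_synonym 'k mpoly = "(nat \<Rightarrow>\<^sub>0 nat) \<Rightarrow>\<^sub>0 'k"

definition mpoly_ring :: "nat \<Rightarrow> 'k::field mpoly ring" where
  "mpoly_ring n =
    \<lparr> carrier = {p. \<forall>m \<in> Poly_Mapping.keys p. Poly_Mapping.keys m \<subseteq> {..<n}},
      monoid.mult = (*), one = 1, ring.zero = 0, add = (+) \<rparr>"

definition mpoly_Var :: "nat \<Rightarrow> 'k::field mpoly" where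
  "mpoly_Var i = Poly_Mapping.single (Poly_Mapping.single i 1) 1"

definition mpoly_Const :: "'k::field \<Rightarrow> 'k mpoly" where
  "mpoly_Const c = Poly_Mapping.single 0 c"

lemma mpoly_Var_carrier: "i < n \<Longrightarrow> mpoly_Var i \<in> carrier (mpoly_ring n)"
  by (auto simp: mpoly_ring_def mpoly_Var_def)

lemma mpoly_Const_carrier: "mpoly_Const c \<in> carrier (mpoly_ring n)"
  by (auto simp: mpoly_ring_def mpoly_Const_def)

lemma cring_mpoly_ring: "cring (mpoly_ring n :: 'k::field mpoly ring)"
proof (rule cringI)
  let ?R = "mpoly_ring n :: 'k mpoly ring"
  have add: "p + q \<in> carrier ?R" if "p \<in> carrier ?R" "q \<in> carrier ?R" for p q
    using that Poly_Mapping.keys_add[of p q] by (auto simp: mpoly_ring_def)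
  have uminus: "- p \<in> carrier ?R" if "p \<in> carrier ?R" for p
    using that by (auto simp: mpoly_ring_def)
  have mult: "p * q \<in> carrier ?R" if "p \<in> carrier ?R" "q \<in> carrier ?R" for p q
  proof -
    have "Poly_Mapping.keys m \<subseteq> {..<n}" if "m \<in> Poly_Mapping.keys (p * q)" for m
    proof -
      obtain a b where ab: "m = a + b" "a \<in> Poly_Mapping.keys p" "b \<in> Poly_Mapping.keys q"
        using Poly_Mapping.keys_mult[of p q] \<open>m \<in> Poly_Mapping.keys (p * q)\<close> by blast
      have "Poly_Mapping.keys a \<subseteq> {..<n}" "Poly_Mapping.keys b \<subseteq> {..<n}"
        using \<open>p \<in> carrier ?R\<close> \<open>q \<in> carrier ?R\<close> ab by (auto simp: mpoly_ring_def)
      with Poly_Mapping.keys_add[of a b] show ?thesis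
        using ab by blast
    qed
    thus ?thesis
      by (simp add: mpoly_ring_def)
  qed
  have zero: "0 \<in> carrier ?R" and one: "1 \<in> carrier ?R"
    by (simp_all add: mpoly_ring_def)
  have simps: "x \<oplus>\<^bsub>?R\<^esub> y = x + y" "x \<otimes>\<^bsub>?R\<^esub> y = x * y" "\<zero>\<^bsub>?R\<^esub> = 0" "\<one>\<^bsub>?R\<^esub> = 1" for x y
    by (simp_all add: mpoly_ring_def)
  show "abelian_group ?R"
  proof (rule abelian_groupI, unfold simps)
    fix x assume "x \<in> carrier ?R"
    thus "\<exists>y\<in>carrier ?R. y + x = 0"
      using uminus[of x] by (intro bexI[of _ "- x"]) simp_all
  qed (simp_all only: add zero ac_simps add_0_left add_0_right)
  show "comm_monoid ?R"
    by (rule comm_monoidI, unfold simps)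
       (simp_all only: mult one ac_simps mult_1_left mult_1_right)
  show "(x \<oplus>\<^bsub>?R\<^esub> y) \<otimes>\<^bsub>?R\<^esub> z = x \<otimes>\<^bsub>?R\<^esub> z \<oplus>\<^bsub>?R\<^esub> y \<otimes>\<^bsub>?R\<^esub> z" for x y z
    unfolding simps by (rule distrib_right)
qed

text \<open>Powers are taken in the monoid of ideals, with unit the whole ring.\<close>

abbreviation ideal_power :: "('a, 'b) ring_scheme \<Rightarrow> 'a set \<Rightarrow> nat \<Rightarrow> 'a set" where
  "ideal_power R J q \<equiv> J [^]\<^bsub>ideals_set R\<^esub> q"

definition affine_space :: "nat \<Rightarrow> (nat \<Rightarrow> 'k) set" where
  "affine_space n = {..<n} \<rightarrow>\<^sub>E UNIV"

definition point_ideal :: "nat \<Rightarrow> (nat \<Rightarrow> 'k::field) \<Rightarrow> 'k mpoly set" where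
  "point_ideal n a = Idl\<^bsub>mpoly_ring n\<^esub> ((\<lambda>i. mpoly_Var i - mpoly_Const (a i)) ` {..<n})"

definition Phi_star :: "nat \<Rightarrow> nat \<Rightarrow> 'k::field mpoly set \<Rightarrow> 'k mpoly set" where
  "Phi_star n q I =
    (\<Inter>a \<in> affine_space n. I <+>\<^bsub>mpoly_ring n\<^esub> ideal_power (mpoly_ring n) (point_ideal n a) q)"

text \<open>The image \<open>J / I\<close> of \<open>J \<supseteq> I\<close> in \<open>R / I\<close>, as a set of cosets.\<close>

definition quot_ideal :: "('a, 'b) ring_scheme \<Rightarrow> 'a set \<Rightarrow> 'a set \<Rightarrow> 'a set set" where
  "quot_ideal R J I = (\<lambda>f. I +>\<^bsub>R\<^esub> f) ` J"

definition max_ideals :: "('a, 'b) ring_scheme \<Rightarrow> 'a set set" where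
  "max_ideals A = {M. maximalideal M A}"

text \<open>The intersection with the carrier makes the empty intersection equal to the whole ring.\<close>

definition ideals_Inter :: "('a, 'b) ring_scheme \<Rightarrow> 'a set set \<Rightarrow> 'a set" where
  "ideals_Inter A \<J> = carrier A \<inter> \<Inter>\<J>"

end

theory Submission
  imports Defs
begin

text \<open>
  A coset of \<open>f\<close> lies in the image of an ideal \<open>J\<close> in \<open>R / I\<close> exactly if \<open>f\<close> lies in \<open>I + J\<close>, and
  powers of ideals commute with passage to the quotient.  The maximal ideals of \<open>R / I\<close> are the images
  of the maximal ideals of \<open>R\<close> above \<open>I\<close>, which by the weak Nullstellensatz are the ideals
  \<open>\<mm>\<^sub>a\<close> of the common zeros \<open>a\<close> of \<open>I\<close>.  Hence a coset of \<open>f\<close> lies in the right-hand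
  side exactly if \<open>f \<in> I + \<mm>\<^sub>a\<^sup>q\<close> for every zero \<open>a\<close> of \<open>I\<close>.  A point \<open>a\<close> that is not a
  zero of \<open>I\<close> imposes no condition: there \<open>I + \<mm>\<^sub>a = R\<close> and therefore also
  \<open>I + \<mm>\<^sub>a\<^sup>q = R\<close> (\<open>comaximal_point_ideal_power\<close>).  So the condition is the same as
  membership in the intersection over all points.

  The substantial part is the weak Nullstellensatz over an arbitrary algebraically closed field,
  \<open>maximalideal_mpoly_iff\<close>.  It is obtained by extending a \<open>k\<close>-valued point one coordinate at
  a time: a specialization of \<open>D\<close> extends to \<open>D[x]\<close>, a domain, whenever it avoids the zeros of one
  nonzero element of \<open>D\<close> (\<open>extend_specialization\<close>).  Only Euclidean division in one variable and the
  existence of roots are used, and the argument yields a zero for every prime ideal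
  (\<open>primeideal_has_zero\<close>).
\<close>

section \<open>Extending specializations by one element\<close>

text \<open>
  If a nonconstant \<open>p\<close> vanished everywhere, then \<open>p + 1\<close> would be a nonconstant polynomial
  without roots.
\<close>

lemma alg_closed_poly_nonroot:
  fixes p :: "'k::alg_closed_field poly"
  assumes "p \<noteq> 0"
  obtains t where "poly p t \<noteq> 0"
proof (cases "Polynomial.degree p = 0")
  case True
  then obtain c where "p = [:c:]" by (rule degree_eq_zeroE)
  with assms that[of 0] show ?thesis by simp
next
  case False
  have "Polynomial.degree (p + 1) = Polynomial.degree p"
    using False by (intro degree_add_eq_left) simp
  with False obtain t where "poly (p + 1) t = 0"
    using alg_closed_imp_poly_has_root[of "p + 1"] by auto
  hence "poly p t = - 1" by (simp add: eq_neg_iff_add_eq_0)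
  thus ?thesis by (intro that[of t]) simp
qed

locale comm_ring_morphism =
  fixes \<phi> :: "'a::comm_ring_1 \<Rightarrow> 'k::comm_ring_1"
  assumes hom_one: "\<phi> 1 = 1"
    and hom_add: "\<phi> (a + b) = \<phi> a + \<phi> b"
    and hom_mult: "\<phi> (a * b) = \<phi> a * \<phi> b"
begin

lemma hom_zero: "\<phi> 0 = 0"
  using hom_add[of 0 0] by simp

lemma hom_uminus: "\<phi> (- a) = - \<phi> a"
  using hom_add[of "- a" a] by (simp add: hom_zero eq_neg_iff_add_eq_0)

lemma hom_diff: "\<phi> (a - b) = \<phi> a - \<phi> b"
  using hom_add[of a "- b"] by (simp add: hom_uminus)

lemma hom_sum: "\<phi> (\<Sum>i\<in>A. f i) = (\<Sum>i\<in>A. \<phi> (f i))"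
  by (induction A rule: infinite_finite_induct) (simp_all add: hom_zero hom_add)

lemma hom_power: "\<phi> (a ^ n) = \<phi> a ^ n"
  by (induction n) (simp_all add: hom_one hom_mult)

lemma map_poly_hom_add: "map_poly \<phi> (p + q) = map_poly \<phi> p + map_poly \<phi> q"
  by (rule poly_eqI) (simp add: coeff_map_poly hom_zero hom_add)

lemma map_poly_hom_diff: "map_poly \<phi> (p - q) = map_poly \<phi> p - map_poly \<phi> q"
  by (rule poly_eqI) (simp add: coeff_map_poly hom_zero hom_diff)

lemma map_poly_hom_mult: "map_poly \<phi> (p * q) = map_poly \<phi> p * map_poly \<phi> q"
  by (rule poly_eqI) (simp add: coeff_map_poly hom_zero coeff_mult hom_mult hom_sum)

lemma hom_poly: "\<phi> (poly p x) = poly (map_poly \<phi> p) (\<phi> x)"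
  by (induction p) (simp_all add: map_poly_pCons hom_zero hom_add hom_mult)

end

text \<open>
  The setting for adjoining one element: \<open>M\<close> is a prime ideal of a ring \<open>E\<close>, and \<open>D\<close> is a
  subring of \<open>E\<close>.  Everything below is a statement about the domain \<open>E / M\<close> and its subring
  generated by the images of \<open>D\<close> and one further element \<open>x\<close>, expressed through congruences
  modulo \<open>M\<close> so that no quotient has to be formed.
\<close>

locale prime_over_subring =
  fixes E D M :: "'a::comm_ring_1 set"
  assumes E_one: "1 \<in> E"
    and E_add: "a \<in> E \<Longrightarrow> b \<in> E \<Longrightarrow> a + b \<in> E"
    and E_mult: "a \<in> E \<Longrightarrow> b \<in> E \<Longrightarrow> a * b \<in> E"
    and D_sub: "D \<subseteq> E"
    and D_one: "1 \<in> D"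
    and D_uminus: "a \<in> D \<Longrightarrow> - a \<in> D"
    and D_add: "a \<in> D \<Longrightarrow> b \<in> D \<Longrightarrow> a + b \<in> D"
    and D_mult: "a \<in> D \<Longrightarrow> b \<in> D \<Longrightarrow> a * b \<in> D"
    and M_zero: "0 \<in> M"
    and M_uminus: "a \<in> M \<Longrightarrow> - a \<in> M"
    and M_add: "a \<in> M \<Longrightarrow> b \<in> M \<Longrightarrow> a + b \<in> M"
    and M_mult: "a \<in> E \<Longrightarrow> b \<in> M \<Longrightarrow> a * b \<in> M"
    and M_proper: "1 \<notin> M"
    and M_prime: "a \<in> E \<Longrightarrow> b \<in> E \<Longrightarrow> a * b \<in> M \<Longrightarrow> a \<in> M \<or> b \<in> M"
begin

lemma D_zero: "0 \<in> D"
  using D_add[OF D_one D_uminus[OF D_one]] by simp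

lemma E_zero: "0 \<in> E"
  using D_zero D_sub by blast

lemma D_diff: "a \<in> D \<Longrightarrow> b \<in> D \<Longrightarrow> a - b \<in> D"
  using D_add[of a "- b"] D_uminus by simp

lemma D_sum: "(\<And>i. i \<in> S \<Longrightarrow> f i \<in> D) \<Longrightarrow> sum f S \<in> D"
  by (induction S rule: infinite_finite_induct) (simp_all add: D_zero D_add)

lemma D_power: "a \<in> D \<Longrightarrow> a ^ n \<in> D"
  by (induction n) (simp_all add: D_one D_mult)

lemma M_diff: "a \<in> M \<Longrightarrow> b \<in> M \<Longrightarrow> a - b \<in> M"
  using M_add[of a "- b"] M_uminus by simp

lemma M_mult_notin: "a \<in> E \<Longrightarrow> b \<in> E \<Longrightarrow> a \<notin> M \<Longrightarrow> b \<notin> M \<Longrightarrow> a * b \<notin> M"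
  using M_prime by blast

lemma M_power_notin: "a \<in> D \<Longrightarrow> a \<notin> M \<Longrightarrow> a ^ n \<notin> M"
proof (induction n)
  case (Suc n)
  have "a \<in> E" "a ^ n \<in> E" using Suc.prems D_sub D_power by blast+
  thus ?case using M_mult_notin Suc by simp
qed (simp add: M_proper)

text \<open>
  \<open>DX\<close> is \<open>D[X]\<close>; its subset \<open>MX\<close>, introduced below, consists of the polynomials that become
  zero over \<open>E / M\<close>.
\<close>

definition DX :: "'a poly set" where
  "DX = {G. \<forall>i. Polynomial.coeff G i \<in> D}"

lemma DX_coeff: "G \<in> DX \<Longrightarrow> Polynomial.coeff G i \<in> D"
  by (simp add: DX_def)

lemma DX_const: "a \<in> D \<Longrightarrow> [:a:] \<in> DX"
  by (auto simp: DX_def D_zero coeff_pCons split: nat.splits)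

lemma DX_zero: "0 \<in> DX"
  by (auto simp: DX_def D_zero)

lemma DX_one: "1 \<in> DX"
  using DX_const[OF D_one] by (simp add: one_pCons)

lemma DX_monom: "a \<in> D \<Longrightarrow> Polynomial.monom a k \<in> DX"
  by (auto simp: DX_def D_zero)

lemma DX_add: "G \<in> DX \<Longrightarrow> H \<in> DX \<Longrightarrow> G + H \<in> DX"
  by (auto simp: DX_def D_add)

lemma DX_uminus: "G \<in> DX \<Longrightarrow> - G \<in> DX"
  by (auto simp: DX_def D_uminus)

lemma DX_diff: "G \<in> DX \<Longrightarrow> H \<in> DX \<Longrightarrow> G - H \<in> DX"
  by (auto simp: DX_def D_diff)

lemma DX_smult: "a \<in> D \<Longrightarrow> G \<in> DX \<Longrightarrow> smult a G \<in> DX"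
  by (auto simp: DX_def D_mult)

lemma DX_mult: "G \<in> DX \<Longrightarrow> H \<in> DX \<Longrightarrow> G * H \<in> DX"
  by (auto simp: DX_def coeff_mult intro!: D_sum D_mult)

lemma poly_DX_closed:
  assumes "x \<in> E" "G \<in> DX"
  shows "poly G x \<in> E"
  using assms(2)
proof (induction G)
  case 0
  show ?case by (simp add: E_zero)
next
  case (pCons a p)
  have "a \<in> D" using DX_coeff[OF pCons.prems, of 0] by simp
  moreover have "p \<in> DX"
    unfolding DX_def using DX_coeff[OF pCons.prems, of "Suc _"] by simp
  ultimately show ?case using pCons.IH assms(1) D_sub by (auto intro!: E_add E_mult)
qed

text \<open>
  Division with remainder, with denominators cleared by powers of the leading coefficient.  The
  bound on the degree of the quotient has to be recorded separately, because degrees need not add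
  up in a ring with zero divisors.
\<close>

lemma pseudo_division:
  fixes f :: "'a poly"
  defines "d \<equiv> Polynomial.degree f" and "c \<equiv> Polynomial.lead_coeff f"
  assumes f: "f \<in> DX" and d: "d > 0" and g: "g \<in> DX"
  obtains N h r where "h \<in> DX" "r \<in> DX" "smult (c ^ N) g = f * h + r"
    "Polynomial.degree r < d" "Polynomial.degree h \<le> Polynomial.degree g - d"
proof -
  have "\<exists>N. \<exists>h\<in>DX. \<exists>r\<in>DX. smult (c ^ N) g = f * h + r \<and> Polynomial.degree r < d \<and>
      Polynomial.degree h \<le> Polynomial.degree g - d"
    using g
  proof (induction "Polynomial.degree g" arbitrary: g rule: less_induct)
    case less
    show ?case
    proof (cases "Polynomial.degree g < d")
      case True
      thus ?thesis
        using less.prems DX_zero by (intro exI[of _ 0] bexI[of _ 0] bexI[of _ g]) auto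
    next
      case False
      define k where "k = Polynomial.degree g - d"
      define m where "m = Polynomial.monom (Polynomial.lead_coeff g) k"
      define g' where "g' = smult c g - f * m"
      have c: "c \<in> D" unfolding c_def by (rule DX_coeff[OF f])
      have m: "m \<in> DX" unfolding m_def by (intro DX_monom DX_coeff less.prems)
      have g': "g' \<in> DX" unfolding g'_def by (intro DX_diff DX_smult DX_mult c f m less.prems)
      have dg: "Polynomial.degree g = k + d" using False by (simp add: k_def)
      have degm: "Polynomial.degree m \<le> k" unfolding m_def by (rule degree_monom_le)
      have "Polynomial.degree (f * m) \<le> d + k"
        using degree_mult_le[of f m] degm by (simp add: d_def)
      hence "Polynomial.degree g' \<le> k + d"
        unfolding g'_def using dg degree_smult_le[of c g] by (intro degree_diff_le) simp_all
      moreover have "Polynomial.coeff g' (k + d) = 0"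
        using dg by (simp add: g'_def m_def c_def d_def coeff_mult_degree_sum coeff_monom_mult mult.commute[of f])
      ultimately have deg: "Polynomial.degree g' < Polynomial.degree g"
        using d dg by (metis add_gr_0 degree_0 eq_zero_or_degree_less)
      from less.hyps[OF deg g'] obtain N h r where IH: "h \<in> DX" "r \<in> DX"
        "smult (c ^ N) g' = f * h + r" "Polynomial.degree r < d" "Polynomial.degree h \<le> Polynomial.degree g' - d"
        by blast
      have "smult (c ^ Suc N) g = f * (h + smult (c ^ N) m) + r"
      proof -
        have "smult (c ^ Suc N) g = smult (c ^ N) (g' + f * m)"
          by (simp add: g'_def mult.commute)
        thus ?thesis using IH(3) by (simp add: smult_add_right algebra_simps)
      qed
      moreover have "h + smult (c ^ N) m \<in> DX"
        by (intro DX_add DX_smult IH m D_power c)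
      moreover have "Polynomial.degree (h + smult (c ^ N) m) \<le> Polynomial.degree g - d"
      proof (intro degree_add_le)
        show "Polynomial.degree h \<le> Polynomial.degree g - d" using IH(5) deg by linarith
        show "Polynomial.degree (smult (c ^ N) m) \<le> Polynomial.degree g - d"
          using degree_smult_le[of "c ^ N" m] degm by (simp add: k_def)
      qed
      ultimately show ?thesis using IH by blast
    qed
  qed
  thus ?thesis using that by blast
qed

definition MX :: "'a poly set" where
  "MX = {G \<in> DX. \<forall>i. Polynomial.coeff G i \<in> M}"

lemma poly_MX_in_M:
  assumes "x \<in> E" "G \<in> MX"
  shows "poly G x \<in> M"
proof -
  have "(\<Sum>i\<in>S. Polynomial.coeff G i * x ^ i) \<in> M" for S :: "nat set"
  proof (induction S rule: infinite_finite_induct)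
    case (insert i S)
    have "x ^ i \<in> E" by (induction i) (simp_all add: E_one E_mult assms(1))
    hence "Polynomial.coeff G i * x ^ i \<in> M"
      using M_mult[of "x ^ i" "Polynomial.coeff G i"] assms(2) by (simp add: MX_def mult.commute)
    thus ?case using insert by (simp add: M_add)
  qed (simp_all add: M_zero)
  thus ?thesis by (simp add: poly_altdef)
qed

text \<open>
  Minimality forces the leading coefficient to survive modulo \<open>M\<close>: otherwise the leading term
  could be dropped without changing the value at \<open>x\<close> modulo \<open>M\<close>.  The competitors are all
  polynomials with the same value modulo \<open>M\<close>, which covers both the relations satisfied by
  \<open>x\<close> and the minimal multiples in the Bezout argument below.
\<close>

lemma minimal_degree_lead_coeff:
  assumes x: "x \<in> E" and f: "f \<in> DX" "f \<notin> MX"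
    and min: "\<And>g. g \<in> DX \<Longrightarrow> poly g x - poly f x \<in> M \<Longrightarrow> g \<notin> MX \<Longrightarrow>
      Polynomial.degree f \<le> Polynomial.degree g"
  shows "Polynomial.lead_coeff f \<notin> M"
proof
  define m where "m = Polynomial.monom (Polynomial.lead_coeff f) (Polynomial.degree f)"
  assume lc: "Polynomial.lead_coeff f \<in> M"
  hence mMX: "m \<in> MX"
    using f DX_coeff[of f] by (auto simp: MX_def m_def DX_monom M_zero)
  have "f - m \<in> DX" using mMX f by (auto intro: DX_diff simp: MX_def)
  moreover have "poly (f - m) x - poly f x \<in> M"
    using poly_MX_in_M[OF x mMX] by (simp add: M_uminus)
  moreover have notin: "f - m \<notin> MX"
  proof
    assume "f - m \<in> MX"
    hence "(f - m) + m \<in> MX"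
      using mMX by (simp only: MX_def mem_Collect_eq coeff_add DX_add M_add simp_thms)
    with f show False by simp
  qed
  ultimately have "Polynomial.degree f \<le> Polynomial.degree (f - m)" by (rule min)
  moreover have "Polynomial.degree (f - m) \<le> Polynomial.degree f"
    unfolding m_def by (intro degree_diff_le) (simp_all add: degree_monom_le)
  moreover have "Polynomial.coeff (f - m) (Polynomial.degree f) = 0"
    by (simp add: m_def)
  ultimately have "f - m = 0" by (metis le_antisym leading_coeff_0_iff)
  with notin show False by (simp add: MX_def DX_zero M_zero)
qed

lemma minimal_relation_nonconstant:
  assumes x: "x \<in> E"
    and f: "f \<in> DX" "poly f x \<in> M" "f \<notin> MX"
    and min: "\<And>g. g \<in> DX \<Longrightarrow> poly g x \<in> M \<Longrightarrow> g \<notin> MX \<Longrightarrow>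
      Polynomial.degree f \<le> Polynomial.degree g"
  shows "Polynomial.lead_coeff f \<notin> M" and "Polynomial.degree f > 0"
proof -
  have "poly g x \<in> M" if "poly g x - poly f x \<in> M" for g
    using M_add[OF that f(2)] by simp
  thus lc: "Polynomial.lead_coeff f \<notin> M"
    using minimal_degree_lead_coeff[OF x f(1,3)] min by blast
  show "Polynomial.degree f > 0"
  proof (rule ccontr)
    assume "\<not> Polynomial.degree f > 0"
    then obtain a where "f = [:a:]" by (metis degree_eq_zeroE neq0_conv)
    with lc f(2) show False by simp
  qed
qed

text \<open>
  Let \<open>f\<close> be a minimal polynomial of \<open>x\<close> modulo \<open>M\<close>.  Over the fraction field of \<open>D / (D \<inter> M)\<close>
  it is irreducible, so \<open>B\<close>, which does not vanish at \<open>x\<close>, is coprime to it, and clearing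
  denominators in a Bezout identity gives a multiple of \<open>B(x)\<close> that is congruent to a nonzero
  constant.  The proof runs the Euclidean argument directly: a multiple \<open>\<gamma>\<close> of minimal degree,
  nonzero at \<open>x\<close>, must be constant, since dividing \<open>f\<close> by it would otherwise produce either a
  smaller such multiple or a factorization of \<open>f\<close>.
\<close>

lemma bezout_mod_prime:
  assumes x: "x \<in> E"
    and f: "f \<in> DX" "poly f x \<in> M" "f \<notin> MX"
    and min: "\<And>g. g \<in> DX \<Longrightarrow> poly g x \<in> M \<Longrightarrow> g \<notin> MX \<Longrightarrow>
      Polynomial.degree f \<le> Polynomial.degree g"
    and B: "B \<in> DX" "poly B x \<notin> M"
  obtains u e where "u \<in> DX" "e \<in> D" "e \<notin> M" "poly u x * poly B x - e \<in> M"
proof -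
  let ?c = "Polynomial.lead_coeff f"
  let ?d = "Polynomial.degree f"
  have c: "?c \<notin> M" "?c \<in> D" and d: "?d > 0"
    using minimal_relation_nonconstant[OF x f min] DX_coeff[OF f(1)] by blast+
  define P where "P = (\<lambda>\<gamma>. \<gamma> \<in> DX \<and> poly \<gamma> x \<notin> M \<and> (\<exists>u\<in>DX. poly u x * poly B x - poly \<gamma> x \<in> M))"
  have "P B" using B by (auto simp: P_def M_zero intro!: bexI[of _ 1] DX_one)
  then obtain \<gamma> where P: "P \<gamma>" and least: "\<And>\<gamma>'. P \<gamma>' \<Longrightarrow> Polynomial.degree \<gamma> \<le> Polynomial.degree \<gamma>'"
    using ex_has_least_nat[of P B Polynomial.degree] by blast
  from P obtain u where \<gamma>: "\<gamma> \<in> DX" "poly \<gamma> x \<notin> M" and u: "u \<in> DX" "poly u x * poly B x - poly \<gamma> x \<in> M"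
    unfolding P_def by blast
  have inE: "poly G x \<in> E" if "G \<in> DX" for G using poly_DX_closed[OF x that] .
  have P_step: "P r" if "v \<in> DX" "r \<in> DX" "poly r x \<notin> M" "poly v x * poly \<gamma> x - poly r x \<in> M" for v r
  proof -
    have "poly (v * u) x * poly B x - poly r x =
      poly v x * (poly u x * poly B x - poly \<gamma> x) + (poly v x * poly \<gamma> x - poly r x)"
      by (simp add: algebra_simps)
    also have "\<dots> \<in> M" by (intro M_add M_mult inE that u)
    finally show ?thesis unfolding P_def using that u(1) DX_mult by blast
  qed
  have lc: "Polynomial.lead_coeff \<gamma> \<notin> M"
  proof (rule minimal_degree_lead_coeff[OF x \<gamma>(1)])
    show "\<gamma> \<notin> MX" using poly_MX_in_M[OF x] \<gamma>(2) by blast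
    fix g assume g: "g \<in> DX" "poly g x - poly \<gamma> x \<in> M"
    have "poly g x \<notin> M" using M_diff[OF _ g(2), of "poly g x"] \<gamma>(2) by auto
    hence "P g" using P_step[of 1 g] g M_uminus[OF g(2)] by (simp add: DX_one)
    thus "Polynomial.degree \<gamma> \<le> Polynomial.degree g" by (rule least)
  qed
  have "Polynomial.degree \<gamma> = 0"
  proof (rule ccontr)
    assume "Polynomial.degree \<gamma> \<noteq> 0"
    hence pos: "Polynomial.degree \<gamma> > 0" by simp
    \<comment> \<open>Reducing \<open>\<gamma>\<close> modulo \<open>f\<close> only changes its value at \<open>x\<close> by a unit factor of the fraction field.\<close>
    have less: "Polynomial.degree \<gamma> < ?d"
    proof -
      obtain N h r where hr: "h \<in> DX" "r \<in> DX" "smult (?c ^ N) \<gamma> = f * h + r" "Polynomial.degree r < ?d"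
        using pseudo_division[OF f(1) d \<gamma>(1)] by blast
      have eq: "?c ^ N * poly \<gamma> x = poly f x * poly h x + poly r x"
        using arg_cong[OF hr(3), of "\<lambda>p. poly p x"] by simp
      have fh: "poly f x * poly h x \<in> M"
        using M_mult[OF inE[OF hr(1)] f(2)] by (simp add: mult.commute)
      have "?c ^ N * poly \<gamma> x \<notin> M"
        using c D_sub by (intro M_mult_notin M_power_notin inE \<gamma>) (auto intro: D_power)
      hence "poly r x \<notin> M" using eq fh M_add by auto
      hence "P r"
        using P_step[of "[:?c ^ N:]" r] eq fh hr c by (simp add: DX_const D_power)
      from least[OF this] hr show ?thesis by simp
    qed
    let ?e = "Polynomial.lead_coeff \<gamma>"
    obtain N h r where hr: "h \<in> DX" "r \<in> DX" "smult (?e ^ N) f = \<gamma> * h + r"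
      "Polynomial.degree r < Polynomial.degree \<gamma>" "Polynomial.degree h \<le> ?d - Polynomial.degree \<gamma>"
      using pseudo_division[OF \<gamma>(1) pos f(1)] by blast
    have e: "?e \<in> D" by (rule DX_coeff[OF \<gamma>(1)])
    have eq: "?e ^ N * poly f x = poly \<gamma> x * poly h x + poly r x"
      using arg_cong[OF hr(3), of "\<lambda>p. poly p x"] by simp
    have ef: "?e ^ N * poly f x \<in> M"
      using e D_sub D_power by (intro M_mult f) auto
    have rM: "poly r x \<in> M"
    proof (rule ccontr)
      assume "poly r x \<notin> M"
      moreover have "poly (- h) x * poly \<gamma> x - poly r x \<in> M"
        using M_uminus[OF ef] eq by (simp add: mult.commute)
      ultimately have "P r" using P_step[of "- h" r] hr by (simp add: DX_uminus)
      from least[OF this] hr(4) show False by simp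
    qed
    \<comment> \<open>Both \<open>r\<close> and \<open>h\<close> vanish at \<open>x\<close> and have degree less than \<open>f\<close>, so they are zero modulo
      \<open>M\<close>; then so is the multiple \<open>\<gamma> * h + r\<close> of \<open>f\<close>, which its top coefficient contradicts.\<close>
    have rMX: "r \<in> MX" using min[OF hr(2) rM] hr(4) less by force
    have "poly \<gamma> x * poly h x \<in> M" using M_diff[OF ef rM] eq by simp
    hence "poly h x \<in> M" using M_prime inE \<gamma> hr(1) by blast
    hence hMX: "h \<in> MX" using min[OF hr(1)] hr(5) less pos by force
    have "Polynomial.coeff (\<gamma> * h) ?d \<in> M"
    proof -
      have "(\<Sum>i\<in>S. Polynomial.coeff \<gamma> i * Polynomial.coeff h (?d - i)) \<in> M" for S
        using hMX DX_coeff[OF \<gamma>(1)] D_sub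
        by (induction S rule: infinite_finite_induct) (auto simp: MX_def M_zero intro!: M_add M_mult)
      thus ?thesis by (simp add: coeff_mult)
    qed
    hence "Polynomial.coeff (smult (?e ^ N) f) ?d \<in> M"
      unfolding hr(3) using rMX by (simp add: MX_def M_add)
    moreover have "?e ^ N * ?c \<notin> M"
      using c e lc D_sub by (intro M_mult_notin M_power_notin) (auto intro: D_power)
    ultimately show False by simp
  qed
  then obtain e where e: "\<gamma> = [:e:]" by (rule degree_eq_zeroE)
  show ?thesis
    using that[of u e] \<gamma> u e DX_coeff[OF \<gamma>(1), of 0] by simp
qed

text \<open>
  A homomorphism from \<open>D / (D \<inter> M)\<close> to an algebraically closed field extends to the ring generated by
  \<open>x\<close> over it, with a prescribed element \<open>B(x)\<close> not sent to zero, as soon as one suitable element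
  \<open>a\<close> of \<open>D\<close> is not sent to zero.  The value \<open>t\<close> is the image of \<open>x\<close>.

  If \<open>x\<close> is transcendental modulo \<open>M\<close>, any \<open>t\<close> defines an extension, and if some coefficient
  of \<open>B\<close> stays nonzero, then some \<open>t\<close> is not a root of the image of \<open>B\<close>.  If \<open>x\<close> is algebraic with minimal polynomial \<open>f\<close>, the value
  \<open>t\<close> has to be a root of the image of \<open>f\<close>.  Such a root exists if the leading coefficient of
  \<open>f\<close> is preserved, and then pseudo-division by \<open>f\<close> shows that every relation of \<open>x\<close> holds
  for \<open>t\<close>.  The Bezout constant is the other factor of \<open>a\<close>: it keeps \<open>B(t)\<close> nonzero.
\<close>

theorem extend_specialization:
  fixes x :: 'a
  assumes x: "x \<in> E" and B: "B \<in> DX" "poly B x \<notin> M"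
  shows "\<exists>a \<in> D - M. \<forall>\<phi> :: 'a \<Rightarrow> 'k::alg_closed_field.
    comm_ring_morphism \<phi> \<longrightarrow> (\<forall>d \<in> D \<inter> M. \<phi> d = 0) \<longrightarrow> \<phi> a \<noteq> 0 \<longrightarrow>
      (\<exists>t. (\<forall>G\<in>DX. poly G x \<in> M \<longrightarrow> poly (map_poly \<phi> G) t = 0) \<and> poly (map_poly \<phi> B) t \<noteq> 0)"
proof (cases "\<forall>G\<in>DX. poly G x \<in> M \<longrightarrow> G \<in> MX")
  case True
  obtain i where i: "Polynomial.coeff B i \<notin> M"
    using B poly_MX_in_M[OF x, of B] by (auto simp: MX_def)
  show ?thesis
  proof (intro bexI[of _ "Polynomial.coeff B i"] allI impI)
    show "Polynomial.coeff B i \<in> D - M" using i DX_coeff[OF B(1)] by simp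
    fix \<phi> :: "'a \<Rightarrow> 'k"
    assume "comm_ring_morphism \<phi>" and van: "\<forall>d \<in> D \<inter> M. \<phi> d = 0"
      and nz: "\<phi> (Polynomial.coeff B i) \<noteq> 0"
    interpret comm_ring_morphism \<phi> by fact
    have "Polynomial.coeff (map_poly \<phi> B) i \<noteq> 0" using nz by (simp add: coeff_map_poly hom_zero)
    hence "map_poly \<phi> B \<noteq> 0" by auto
    then obtain t where "poly (map_poly \<phi> B) t \<noteq> 0" by (rule alg_closed_poly_nonroot)
    moreover have "map_poly \<phi> G = 0" if "G \<in> DX" "poly G x \<in> M" for G
      using True that van by (intro poly_eqI) (auto simp: coeff_map_poly hom_zero MX_def DX_def)
    ultimately show "\<exists>t. (\<forall>G\<in>DX. poly G x \<in> M \<longrightarrow> poly (map_poly \<phi> G) t = 0) \<and> poly (map_poly \<phi> B) t \<noteq> 0"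
      by auto
  qed
next
  case False
  define Q where "Q = (\<lambda>G. G \<in> DX \<and> poly G x \<in> M \<and> G \<notin> MX)"
  from False obtain f where Qf: "Q f" and least: "\<And>g. Q g \<Longrightarrow> Polynomial.degree f \<le> Polynomial.degree g"
    using ex_has_least_nat[of Q _ Polynomial.degree] unfolding Q_def by blast
  hence f: "f \<in> DX" "poly f x \<in> M" "f \<notin> MX"
    and min: "\<And>g. g \<in> DX \<Longrightarrow> poly g x \<in> M \<Longrightarrow> g \<notin> MX \<Longrightarrow> Polynomial.degree f \<le> Polynomial.degree g"
    unfolding Q_def by blast+
  let ?c = "Polynomial.lead_coeff f"
  let ?d = "Polynomial.degree f"
  have c: "?c \<notin> M" "?c \<in> D" and d: "?d > 0"
    using minimal_relation_nonconstant[OF x f min] DX_coeff[OF f(1)] by blast+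
  obtain u e where u: "u \<in> DX" and e: "e \<in> D" "e \<notin> M" and ue: "poly u x * poly B x - e \<in> M"
    using bezout_mod_prime[OF x f min B] by blast
  show ?thesis
  proof (intro bexI[of _ "?c * e"] allI impI)
    have "?c * e \<notin> M" using c e D_sub by (intro M_mult_notin) auto
    thus "?c * e \<in> D - M" using c e by (simp add: D_mult)
    fix \<phi> :: "'a \<Rightarrow> 'k"
    assume "comm_ring_morphism \<phi>" and van: "\<forall>d \<in> D \<inter> M. \<phi> d = 0"
      and nz: "\<phi> (?c * e) \<noteq> 0"
    interpret comm_ring_morphism \<phi> by fact
    from nz have nzc: "\<phi> ?c \<noteq> 0" and nze: "\<phi> e \<noteq> 0" by (auto simp: hom_mult)
    have "Polynomial.degree (map_poly \<phi> f) = ?d"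
      using nzc by (rule map_poly_degree_eq)
    then obtain t where t: "poly (map_poly \<phi> f) t = 0"
      using d alg_closed_imp_poly_has_root[of "map_poly \<phi> f"] by auto
    have kills: "poly (map_poly \<phi> G) t = 0" if G: "G \<in> DX" "poly G x \<in> M" for G
    proof -
      obtain N h r where hr: "h \<in> DX" "r \<in> DX" "smult (?c ^ N) G = f * h + r" "Polynomial.degree r < ?d"
        using pseudo_division[OF f(1) d G(1)] by blast
      have eq: "?c ^ N * poly G x = poly h x * poly f x + poly r x"
        using arg_cong[OF hr(3), of "\<lambda>p. poly p x"] by (simp add: mult.commute)
      have "?c ^ N * poly G x \<in> M" using c D_sub D_power by (intro M_mult G) auto
      moreover have "poly h x * poly f x \<in> M" by (intro M_mult f poly_DX_closed x hr)
      ultimately have "poly r x \<in> M" using M_diff eq by (metis add_diff_cancel_left')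
      hence "r \<in> MX" using min[OF hr(2)] hr(4) by force
      hence "map_poly \<phi> r = 0"
        using van by (intro poly_eqI) (auto simp: coeff_map_poly hom_zero MX_def DX_def)
      hence "map_poly \<phi> ([:?c ^ N:] * G) = map_poly \<phi> f * map_poly \<phi> h"
        using hr(3) by (simp add: map_poly_hom_add map_poly_hom_mult)
      from arg_cong[OF this, of "\<lambda>p. poly p t"] have "\<phi> ?c ^ N * poly (map_poly \<phi> G) t = 0"
        using t by (simp add: map_poly_hom_mult map_poly_pCons hom_zero hom_power del: mult_pCons_left)
      with nzc show ?thesis by simp
    qed
    have "poly (map_poly \<phi> (u * B - [:e:])) t = 0"
      using ue by (intro kills DX_diff DX_mult DX_const u B e) simp
    hence "poly (map_poly \<phi> u) t * poly (map_poly \<phi> B) t = \<phi> e"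
      by (simp add: map_poly_hom_mult map_poly_hom_diff map_poly_pCons hom_zero)
    with nze have "poly (map_poly \<phi> B) t \<noteq> 0" by auto
    with kills show "\<exists>t. (\<forall>G\<in>DX. poly G x \<in> M \<longrightarrow> poly (map_poly \<phi> G) t = 0) \<and> poly (map_poly \<phi> B) t \<noteq> 0"
      by blast
  qed
qed

end

section \<open>Polynomial rings, evaluation and ideals of points\<close>

lemma mpoly_ring_simps:
  "monoid.mult (mpoly_ring n) = (*)" "one (mpoly_ring n) = 1"
  "ring.zero (mpoly_ring n) = 0" "add (mpoly_ring n) = (+)"
  by (simp_all add: mpoly_ring_def)

lemma mpoly_carrier_mono: "i \<le> n \<Longrightarrow> carrier (mpoly_ring i) \<subseteq> carrier (mpoly_ring n)"
  by (force simp: mpoly_ring_def)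

lemma mpoly_carrier_one: "1 \<in> carrier (mpoly_ring n)"
  using monoid.one_closed[OF ring.axioms(2)[OF cring.axioms(1)[OF cring_mpoly_ring]]]
  by (simp add: mpoly_ring_simps)

lemma mpoly_carrier_add: "p \<in> carrier (mpoly_ring n) \<Longrightarrow> q \<in> carrier (mpoly_ring n) \<Longrightarrow> p + q \<in> carrier (mpoly_ring n)"
  using ring.ring_simprules(1)[OF cring.axioms(1)[OF cring_mpoly_ring], of p n q]
  by (simp add: mpoly_ring_simps)

lemma mpoly_carrier_mult: "p \<in> carrier (mpoly_ring n) \<Longrightarrow> q \<in> carrier (mpoly_ring n) \<Longrightarrow> p * q \<in> carrier (mpoly_ring n)"
  using ring.ring_simprules(5)[OF cring.axioms(1)[OF cring_mpoly_ring], of p n q]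
  by (simp add: mpoly_ring_simps)

lemma mpoly_carrier_uminus: "p \<in> carrier (mpoly_ring n) \<Longrightarrow> - p \<in> carrier (mpoly_ring n)"
  by (auto simp: mpoly_ring_def)

lemma mpoly_carrier_diff: "p \<in> carrier (mpoly_ring n) \<Longrightarrow> q \<in> carrier (mpoly_ring n) \<Longrightarrow> p - q \<in> carrier (mpoly_ring n)"
  using mpoly_carrier_add[of p n "- q"] mpoly_carrier_uminus[of q n] by simp

lemma mpoly_Const_hom:
  "mpoly_Const 0 = 0" "mpoly_Const 1 = 1"
  "mpoly_Const (a + b) = mpoly_Const a + mpoly_Const b"
  "mpoly_Const (a * b) = mpoly_Const a * mpoly_Const b"
  by (simp_all add: mpoly_Const_def single_add mult_single)

lemma poly_mapping_sum_singles:
  assumes "finite S" "Poly_Mapping.keys p \<subseteq> S"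
  shows "(\<Sum>m\<in>S. Poly_Mapping.single m (Poly_Mapping.lookup p m)) = p"
proof (rule poly_mapping_eqI)
  fix k
  show "Poly_Mapping.lookup (\<Sum>m\<in>S. Poly_Mapping.single m (Poly_Mapping.lookup p m)) k = Poly_Mapping.lookup p k"
    using assms by (auto simp: lookup_sum lookup_single when_def in_keys_iff)
qed

lemma prod_single_one:
  "(\<Prod>i\<in>S. Poly_Mapping.single (f i) 1) = Poly_Mapping.single (\<Sum>i\<in>S. f i) (1 :: 'k::field)"
  for f :: "'i \<Rightarrow> nat \<Rightarrow>\<^sub>0 nat"
  by (induction S rule: infinite_finite_induct) (simp_all add: mult_single)

lemma mpoly_Var_power: "mpoly_Var i ^ k = (Poly_Mapping.single (Poly_Mapping.single i k) 1 :: 'k::field mpoly)"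
  by (induction k) (simp_all add: mpoly_Var_def mult_single flip: single_add)

lemma monomial_eq_prod:
  "Poly_Mapping.single m c =
    mpoly_Const c * (\<Prod>i\<in>Poly_Mapping.keys m. mpoly_Var i ^ Poly_Mapping.lookup m i :: 'k::field mpoly)"
  by (simp add: mpoly_Var_power prod_single_one poly_mapping_sum_singles mpoly_Const_def mult_single)

lemma mpoly_carrier_induct [consumes 1, case_names Const Var add mult]:
  fixes p :: "'k::field mpoly"
  assumes p: "p \<in> carrier (mpoly_ring n)"
    and Const: "\<And>c. P (mpoly_Const c)"
    and Var: "\<And>i. i < n \<Longrightarrow> P (mpoly_Var i)"
    and add: "\<And>p q. p \<in> carrier (mpoly_ring n) \<Longrightarrow> q \<in> carrier (mpoly_ring n) \<Longrightarrow> P p \<Longrightarrow> P q \<Longrightarrow> P (p + q)"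
    and mult: "\<And>p q. p \<in> carrier (mpoly_ring n) \<Longrightarrow> q \<in> carrier (mpoly_ring n) \<Longrightarrow> P p \<Longrightarrow> P q \<Longrightarrow> P (p * q)"
  shows "P p"
proof -
  define P' where "P' = (\<lambda>p. p \<in> carrier (mpoly_ring n) \<and> P p)"
  have P'Const: "P' (mpoly_Const c)" for c by (simp add: P'_def Const mpoly_Const_carrier)
  have P'01: "P' 0" "P' 1" using P'Const[of 0] P'Const[of 1] by (simp_all add: mpoly_Const_hom)
  have P'mult: "P' (p * q)" if "P' p" "P' q" for p q using that mult mpoly_carrier_mult by (auto simp: P'_def)
  have P'add: "P' (p + q)" if "P' p" "P' q" for p q using that add mpoly_carrier_add by (auto simp: P'_def)
  have P'Var: "P' (mpoly_Var i ^ k)" if "i < n" for i k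
  proof -
    have "P' (mpoly_Var i)" using that by (simp add: P'_def Var mpoly_Var_carrier)
    thus ?thesis by (induction k) (simp_all add: P'01 P'mult)
  qed
  have P'prod: "P' (\<Prod>i\<in>S. mpoly_Var i ^ f i)" if "S \<subseteq> {..<n}" for S and f :: "nat \<Rightarrow> nat"
    using that by (induction S rule: infinite_finite_induct) (simp_all add: P'01 P'mult P'Var)
  have "P' (\<Sum>m\<in>S. Poly_Mapping.single m (Poly_Mapping.lookup p m))" if "S \<subseteq> Poly_Mapping.keys p" for S
    using that
  proof (induction S rule: infinite_finite_induct)
    case (insert m S)
    have "Poly_Mapping.keys m \<subseteq> {..<n}" using insert.prems p by (auto simp: mpoly_ring_def)
    hence "P' (Poly_Mapping.single m (Poly_Mapping.lookup p m))"
      unfolding monomial_eq_prod by (intro P'mult P'Const P'prod)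
    with insert show ?case by (simp add: P'add)
  qed (simp_all add: P'01)
  from this[of "Poly_Mapping.keys p"] show ?thesis
    by (simp add: poly_mapping_sum_singles P'_def)
qed

definition mpoly_eval :: "(nat \<Rightarrow> 'k::field) \<Rightarrow> 'k mpoly \<Rightarrow> 'k" where
  "mpoly_eval \<xi> p = (\<Sum>m\<in>Poly_Mapping.keys p. Poly_Mapping.lookup p m *
      (\<Prod>i\<in>Poly_Mapping.keys m. \<xi> i ^ Poly_Mapping.lookup m i))"

lemma prod_keys_add:
  fixes \<xi> :: "nat \<Rightarrow> 'k::field"
  shows "(\<Prod>i\<in>Poly_Mapping.keys (m + m'). \<xi> i ^ Poly_Mapping.lookup (m + m') i) =
    (\<Prod>i\<in>Poly_Mapping.keys m. \<xi> i ^ Poly_Mapping.lookup m i) *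
    (\<Prod>i\<in>Poly_Mapping.keys m'. \<xi> i ^ Poly_Mapping.lookup m' i)"
proof -
  let ?S = "Poly_Mapping.keys m \<union> Poly_Mapping.keys m'"
  have "(\<Prod>i\<in>Poly_Mapping.keys u. \<xi> i ^ Poly_Mapping.lookup u i) = (\<Prod>i\<in>?S. \<xi> i ^ Poly_Mapping.lookup u i)"
    if "Poly_Mapping.keys u \<subseteq> ?S" for u
    using that by (intro prod.mono_neutral_left) (auto simp: in_keys_iff)
  note S = this
  have "(\<Prod>i\<in>Poly_Mapping.keys (m + m'). \<xi> i ^ Poly_Mapping.lookup (m + m') i) =
    (\<Prod>i\<in>?S. \<xi> i ^ Poly_Mapping.lookup (m + m') i)"
    by (rule S[OF keys_add])
  also have "\<dots> = (\<Prod>i\<in>?S. \<xi> i ^ Poly_Mapping.lookup m i) * (\<Prod>i\<in>?S. \<xi> i ^ Poly_Mapping.lookup m' i)"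
    by (simp add: lookup_add power_add prod.distrib)
  finally show ?thesis using S[of m] S[of m'] by simp
qed

lemma mpoly_eval_hom: "comm_ring_morphism (mpoly_eval \<xi> :: 'k::field mpoly \<Rightarrow> 'k)"
proof -
  define e where "e = (\<lambda>m :: nat \<Rightarrow>\<^sub>0 nat. \<Prod>i\<in>Poly_Mapping.keys m. \<xi> i ^ Poly_Mapping.lookup m i)"
  have eval: "mpoly_eval \<xi> p = (\<Sum>m\<in>S. Poly_Mapping.lookup p m * e m)"
    if "finite S" "Poly_Mapping.keys p \<subseteq> S" for p S
    unfolding mpoly_eval_def e_def using that by (intro sum.mono_neutral_left) (auto simp: in_keys_iff)
  have add: "mpoly_eval \<xi> (p + q) = mpoly_eval \<xi> p + mpoly_eval \<xi> q" for p q
  proof -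
    let ?S = "Poly_Mapping.keys p \<union> Poly_Mapping.keys q"
    have "mpoly_eval \<xi> u = (\<Sum>m\<in>?S. Poly_Mapping.lookup u m * e m)" if "Poly_Mapping.keys u \<subseteq> ?S" for u
      using that by (intro eval) auto
    thus ?thesis
      using keys_add[of p q] by (simp add: lookup_add distrib_right sum.distrib)
  qed
  have zero: "mpoly_eval \<xi> 0 = 0" by (simp add: mpoly_eval_def)
  have sum: "mpoly_eval \<xi> (\<Sum>i\<in>A. f i) = (\<Sum>i\<in>A. mpoly_eval \<xi> (f i))" for A and f :: "(nat \<Rightarrow>\<^sub>0 nat) \<Rightarrow> 'k mpoly"
    by (induction A rule: infinite_finite_induct) (simp_all add: zero add)
  have single: "mpoly_eval \<xi> (Poly_Mapping.single m c) = c * e m" for m c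
    by (subst eval[of "{m}"]) auto
  have e_add: "e (m + m') = e m * e m'" for m m'
    unfolding e_def by (rule prod_keys_add)
  have mult: "mpoly_eval \<xi> (p * q) = mpoly_eval \<xi> p * mpoly_eval \<xi> q" for p q
  proof -
    have "p * q = (\<Sum>m\<in>Poly_Mapping.keys p. \<Sum>m'\<in>Poly_Mapping.keys q.
        Poly_Mapping.single m (Poly_Mapping.lookup p m) * Poly_Mapping.single m' (Poly_Mapping.lookup q m'))"
      by (simp add: poly_mapping_sum_singles flip: sum_product)
    hence "mpoly_eval \<xi> (p * q) = (\<Sum>m\<in>Poly_Mapping.keys p. \<Sum>m'\<in>Poly_Mapping.keys q.
        Poly_Mapping.lookup p m * Poly_Mapping.lookup q m' * (e m * e m'))"
      by (simp add: sum mult_single single e_add)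
    also have "\<dots> = mpoly_eval \<xi> p * mpoly_eval \<xi> q"
      unfolding eval[OF finite_keys subset_refl] sum_product by (simp add: mult_ac)
    finally show ?thesis .
  qed
  have "mpoly_eval \<xi> 1 = 1"
    using single[of 0 1] by (simp add: e_def)
  thus ?thesis
    using add mult by unfold_locales
qed

lemma mpoly_eval_Const: "mpoly_eval \<xi> (mpoly_Const c) = c"
  by (simp add: mpoly_eval_def mpoly_Const_def)

lemma mpoly_eval_Var: "mpoly_eval \<xi> (mpoly_Var i) = \<xi> i"
  by (simp add: mpoly_eval_def mpoly_Var_def)

lemma mpoly_eval_cong:
  assumes "p \<in> carrier (mpoly_ring n)" "\<And>i. i < n \<Longrightarrow> \<xi> i = \<eta> i"
  shows "mpoly_eval \<xi> p = mpoly_eval \<eta> p"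
  unfolding mpoly_eval_def
proof (intro sum.cong prod.cong refl arg_cong2[of _ _ _ _ "(*)"] arg_cong2[of _ _ _ _ "(^)"])
  fix m i assume "m \<in> Poly_Mapping.keys p" "i \<in> Poly_Mapping.keys m"
  with assms show "\<xi> i = \<eta> i" by (auto simp: mpoly_ring_def)
qed

lemma ideal_mpoly_ring:
  fixes J :: "'k::field mpoly set"
  assumes "ideal J (mpoly_ring n)"
  shows ideal_mpoly_sub: "J \<subseteq> carrier (mpoly_ring n)"
    and ideal_mpoly_zero: "0 \<in> J"
    and ideal_mpoly_add: "p \<in> J \<Longrightarrow> q \<in> J \<Longrightarrow> p + q \<in> J"
    and ideal_mpoly_mult: "a \<in> carrier (mpoly_ring n) \<Longrightarrow> p \<in> J \<Longrightarrow> a * p \<in> J"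
    and ideal_mpoly_uminus: "p \<in> J \<Longrightarrow> - p \<in> J"
proof -
  interpret ideal J "mpoly_ring n" by fact
  show "J \<subseteq> carrier (mpoly_ring n)" by (rule a_subset)
  show "0 \<in> J" using additive_subgroup.zero_closed[OF is_additive_subgroup] by (simp add: mpoly_ring_simps)
  show "p \<in> J \<Longrightarrow> q \<in> J \<Longrightarrow> p + q \<in> J" using additive_subgroup.a_closed[OF is_additive_subgroup, of p q] by (simp add: mpoly_ring_simps)
  show mult: "a \<in> carrier (mpoly_ring n) \<Longrightarrow> p \<in> J \<Longrightarrow> a * p \<in> J" for a p
    using I_l_closed[of p a] by (simp add: mpoly_ring_simps)
  show "p \<in> J \<Longrightarrow> - p \<in> J"
    using mult[of "- 1" p, OF mpoly_carrier_uminus[OF mpoly_carrier_one]] by simp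
qed

lemma idealI_mpoly:
  fixes J :: "'k::field mpoly set"
  assumes "J \<subseteq> carrier (mpoly_ring n)" "0 \<in> J"
    and add: "\<And>p q. p \<in> J \<Longrightarrow> q \<in> J \<Longrightarrow> p + q \<in> J"
    and mult: "\<And>a p. a \<in> carrier (mpoly_ring n) \<Longrightarrow> p \<in> J \<Longrightarrow> a * p \<in> J"
  shows "ideal J (mpoly_ring n)"
proof -
  interpret cring "mpoly_ring n :: 'k mpoly ring" by (rule cring_mpoly_ring)
  have inv: "\<ominus>\<^bsub>mpoly_ring n\<^esub> p = - p" if "p \<in> carrier (mpoly_ring n)" for p :: "'k mpoly"
    using that mpoly_carrier_uminus[OF that] by (intro minus_equality) (simp_all add: mpoly_ring_simps)
  have uminus: "- p \<in> J" if "p \<in> J" for p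
    using mult[OF mpoly_carrier_uminus[OF mpoly_carrier_one] that] by simp
  have "subgroup J (add_monoid (mpoly_ring n))"
  proof (rule add.subgroupI)
    show "J \<noteq> {}" using assms(2) by blast
    show "\<ominus>\<^bsub>mpoly_ring n\<^esub> p \<in> J" if "p \<in> J" for p
      using that assms(1) uminus inv by auto
  qed (use assms in \<open>simp_all add: mpoly_ring_simps\<close>)
  thus ?thesis
  proof (intro idealI ring_axioms; unfold mpoly_ring_simps)
    fix p x :: "'k mpoly" assume "p \<in> J" "x \<in> carrier (mpoly_ring n)"
    thus "x * p \<in> J" by (intro mult)
    thus "p * x \<in> J" by (simp add: mult.commute)
  qed (simp_all add: mpoly_ring_simps)
qed

text \<open>
  Modulo the ideal of the point \<open>a\<close> every polynomial is congruent to its value at \<open>a\<close>, since this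
  holds for constants and variables and is preserved by sums and products.
\<close>

lemma point_ideal_eq: "point_ideal n a = {p \<in> carrier (mpoly_ring n). mpoly_eval a p = 0}"
  for a :: "nat \<Rightarrow> 'k::field"
proof -
  let ?R = "mpoly_ring n :: 'k mpoly ring"
  interpret cring ?R by (rule cring_mpoly_ring)
  interpret ev: comm_ring_morphism "mpoly_eval a" by (rule mpoly_eval_hom)
  let ?gens = "(\<lambda>i. mpoly_Var i - mpoly_Const (a i)) ` {..<n}"
  let ?K = "{p \<in> carrier ?R. mpoly_eval a p = 0}"
  have gens: "?gens \<subseteq> carrier ?R"
    by (auto intro!: mpoly_carrier_diff mpoly_Var_carrier mpoly_Const_carrier)
  have K: "ideal ?K ?R"
    by (rule idealI_mpoly)
       (auto simp: ev.hom_zero ev.hom_add ev.hom_mult mpoly_carrier_add mpoly_carrier_mult,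
        auto simp: mpoly_ring_def)
  have sub: "point_ideal n a \<subseteq> ?K"
    unfolding point_ideal_def
    using gens by (intro genideal_minimal K) (auto simp: ev.hom_diff mpoly_eval_Const mpoly_eval_Var)
  have J: "ideal (point_ideal n a) ?R"
    unfolding point_ideal_def by (rule genideal_ideal[OF gens])
  have "p - mpoly_Const (mpoly_eval a p) \<in> point_ideal n a" if "p \<in> carrier ?R" for p
    using that
  proof (induction p rule: mpoly_carrier_induct)
    case (Const c)
    thus ?case using ideal_mpoly_zero[OF J] by (simp add: mpoly_eval_Const)
  next
    case (Var i)
    thus ?case using genideal_self[OF gens] by (auto simp: mpoly_eval_Var point_ideal_def)
  next
    case (add p q)
    thus ?case using ideal_mpoly_add[OF J add.IH] by (simp add: ev.hom_add mpoly_Const_hom algebra_simps)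
  next
    case (mult p q)
    have "p * q - mpoly_Const (mpoly_eval a (p * q)) =
      p * (q - mpoly_Const (mpoly_eval a q)) + mpoly_Const (mpoly_eval a q) * (p - mpoly_Const (mpoly_eval a p))"
      by (simp add: ev.hom_mult mpoly_Const_hom algebra_simps)
    also have "\<dots> \<in> point_ideal n a"
      by (intro ideal_mpoly_add[OF J] ideal_mpoly_mult[OF J] mult mpoly_Const_carrier)
    finally show ?case .
  qed
  hence "?K \<subseteq> point_ideal n a"
    by (fastforce simp: mpoly_Const_hom)
  with sub show ?thesis by blast
qed

text \<open>
  An ideal that strictly contains the ideal of \<open>a\<close> contains some \<open>p\<close> with \<open>p(a) \<noteq> 0\<close>, hence also
  the unit \<open>p(a)\<close>, which is congruent to \<open>p\<close>.
\<close>

lemma maximalideal_point_ideal: "maximalideal (point_ideal n a) (mpoly_ring n)"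
  for a :: "nat \<Rightarrow> 'k::field"
proof -
  let ?R = "mpoly_ring n :: 'k mpoly ring"
  interpret cring ?R by (rule cring_mpoly_ring)
  interpret ev: comm_ring_morphism "mpoly_eval a" by (rule mpoly_eval_hom)
  show ?thesis
  proof (rule maximalidealI)
    show "ideal (point_ideal n a) ?R"
      unfolding point_ideal_def
      by (intro genideal_ideal) (auto intro!: mpoly_carrier_diff mpoly_Var_carrier mpoly_Const_carrier)
    have "(1 :: 'k mpoly) \<notin> point_ideal n a" by (simp add: point_ideal_eq ev.hom_one)
    thus "carrier ?R \<noteq> point_ideal n a" using mpoly_carrier_one by blast
  next
    fix J assume J: "ideal J ?R" and sub: "point_ideal n a \<subseteq> J" "J \<subseteq> carrier ?R"
    show "J = point_ideal n a \<or> J = carrier ?R"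
    proof (cases "J \<subseteq> point_ideal n a")
      case False
      then obtain p where p: "p \<in> J" "mpoly_eval a p \<noteq> 0" using sub by (auto simp: point_ideal_eq)
      let ?c = "mpoly_eval a p"
      have "mpoly_Const ?c - p \<in> point_ideal n a"
        using p sub by (auto simp: point_ideal_eq ev.hom_diff mpoly_eval_Const mpoly_Const_carrier intro!: mpoly_carrier_diff)
      hence "mpoly_Const ?c \<in> J" using ideal_mpoly_add[OF J, of "mpoly_Const ?c - p" p] sub p by auto
      hence "mpoly_Const (1 / ?c) * mpoly_Const ?c \<in> J" by (intro ideal_mpoly_mult[OF J] mpoly_Const_carrier)
      hence "1 \<in> J" using p(2) by (simp flip: mpoly_Const_hom)
      hence "J = carrier ?R" using ideal.one_imp_carrier[OF J] by (simp add: mpoly_ring_simps)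
      thus ?thesis ..
    qed (use sub in blast)
  qed
qed

section \<open>The weak Nullstellensatz\<close>

lemma mpoly_ring_0_Const:
  assumes "p \<in> carrier (mpoly_ring 0)"
  obtains c where "p = mpoly_Const c"
proof -
  have "\<exists>c. p = mpoly_Const c"
    using assms by (induction p rule: mpoly_carrier_induct) (auto simp flip: mpoly_Const_hom)
  thus ?thesis using that by blast
qed

lemma mpoly_as_poly_in_last_Var:
  fixes p :: "'k::field mpoly"
  assumes "p \<in> carrier (mpoly_ring (Suc j))"
  obtains G where "p = poly G (mpoly_Var j)" "\<forall>i. Polynomial.coeff G i \<in> carrier (mpoly_ring j)"
proof -
  let ?C = "carrier (mpoly_ring j :: 'k mpoly ring)"
  have zero: "0 \<in> ?C" by (simp add: mpoly_ring_def)
  have const: "\<forall>i. Polynomial.coeff [:q:] i \<in> ?C" if "q \<in> ?C" for q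
    using that zero by (auto simp: coeff_pCons split: nat.splits)
  have csum: "sum f S \<in> ?C" if "\<And>i. i \<in> S \<Longrightarrow> f i \<in> ?C" for S and f :: "nat \<Rightarrow> 'k mpoly"
    using that by (induction S rule: infinite_finite_induct) (simp_all add: zero mpoly_carrier_add)
  have "\<exists>G. p = poly G (mpoly_Var j) \<and> (\<forall>i. Polynomial.coeff G i \<in> ?C)"
    using assms
  proof (induction p rule: mpoly_carrier_induct)
    case (Const c)
    show ?case
      using const[OF mpoly_Const_carrier] by (intro exI[of _ "[:mpoly_Const c:]"]) simp
  next
    case (Var i)
    show ?case
    proof (cases "i = j")
      case True
      have "\<forall>i. Polynomial.coeff [:0, 1 :: 'k mpoly:] i \<in> ?C"
        using zero mpoly_carrier_one by (auto simp: coeff_pCons split: nat.splits)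
      thus ?thesis using True by (intro exI[of _ "[:0, 1:]"]) simp
    next
      case False
      hence "mpoly_Var i \<in> ?C" using Var by (intro mpoly_Var_carrier) simp
      thus ?thesis using const by (intro exI[of _ "[:mpoly_Var i:]"]) simp
    qed
  next
    case (add p q)
    from add.IH obtain G H where "p = poly G (mpoly_Var j)" "\<forall>i. Polynomial.coeff G i \<in> ?C"
      "q = poly H (mpoly_Var j)" "\<forall>i. Polynomial.coeff H i \<in> ?C" by blast
    thus ?case by (intro exI[of _ "G + H"]) (simp add: mpoly_carrier_add)
  next
    case (mult p q)
    from mult.IH obtain G H where "p = poly G (mpoly_Var j)" "\<forall>i. Polynomial.coeff G i \<in> ?C"
      "q = poly H (mpoly_Var j)" "\<forall>i. Polynomial.coeff H i \<in> ?C" by blast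
    thus ?case
      by (intro exI[of _ "G * H"]) (simp add: coeff_mult csum mpoly_carrier_mult)
  qed
  thus ?thesis using that by blast
qed

text \<open>
  The variables are removed one after another, starting from the last.  At stage \<open>j\<close> there is a
  polynomial \<open>b\<close> in the first \<open>j\<close> variables, outside \<open>M\<close>, such that every zero of
  \<open>M \<inter> k[x\<^sub>0, \<dots>, x\<^bsub>j-1\<^esub>]\<close> at which \<open>b\<close> does not vanish extends to a zero of \<open>M\<close>; the
  passage from \<open>j + 1\<close> to \<open>j\<close> is \<open>extend_specialization\<close> for evaluation homomorphisms.  At
  stage \<open>0\<close> only constants are left: \<open>M\<close> contains no nonzero one, and \<open>b\<close> is a nonzero
  constant, so that the conditions on the empty point hold.
\<close>

lemma primeideal_has_zero:
  fixes M :: "'k::alg_closed_field mpoly set"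
  assumes "primeideal M (mpoly_ring n)"
  shows "\<exists>\<xi> \<in> affine_space n. \<forall>p\<in>M. mpoly_eval \<xi> p = 0"
proof -
  let ?R = "\<lambda>j. mpoly_ring j :: 'k mpoly ring"
  interpret M: primeideal M "?R n" by fact
  note M_ideal = M.is_ideal
  have one: "1 \<notin> M"
    using M.one_imp_carrier M.I_notcarr by (auto simp: mpoly_ring_simps)
  have "\<exists>b \<in> carrier (?R j) - M. \<forall>\<xi>. (\<forall>p \<in> M \<inter> carrier (?R j). mpoly_eval \<xi> p = 0) \<and> mpoly_eval \<xi> b \<noteq> 0 \<longrightarrow>
      (\<exists>\<eta>. \<forall>p\<in>M. mpoly_eval \<eta> p = 0)" if "j \<le> n" for j
    using that
  proof (induction j rule: inc_induct)
    case base
    show ?case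
      using one mpoly_carrier_one M.a_subset by (intro bexI[of _ 1]) blast+
  next
    case (step j)
    let ?x = "mpoly_Var j :: 'k mpoly"
    from step.IH obtain b where b: "b \<in> carrier (?R (Suc j))" "b \<notin> M" and
      ext: "\<And>\<xi>. (\<And>p. p \<in> M \<Longrightarrow> p \<in> carrier (?R (Suc j)) \<Longrightarrow> mpoly_eval \<xi> p = 0) \<Longrightarrow> mpoly_eval \<xi> b \<noteq> 0 \<Longrightarrow>
        \<exists>\<eta>. \<forall>p\<in>M. mpoly_eval \<eta> p = 0"
      by blast
    interpret P: prime_over_subring "carrier (?R n)" "carrier (?R j)" M
    proof
      show "a \<in> carrier (?R n) \<Longrightarrow> c \<in> carrier (?R n) \<Longrightarrow> a * c \<in> M \<Longrightarrow> a \<in> M \<or> c \<in> M" for a c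
        using M.I_prime[of a c] by (simp add: mpoly_ring_simps)
      show "carrier (?R j) \<subseteq> carrier (?R n)" using step.hyps by (intro mpoly_carrier_mono) simp
    qed (fact one mpoly_carrier_one mpoly_carrier_add mpoly_carrier_mult
        mpoly_carrier_uminus ideal_mpoly_ring[OF M_ideal])+
    obtain B where "b = poly B ?x" "\<forall>i. Polynomial.coeff B i \<in> carrier (?R j)"
      by (rule mpoly_as_poly_in_last_Var[OF b(1)])
    hence B: "b = poly B ?x" "B \<in> P.DX" by (simp_all add: P.DX_def)
    have x: "?x \<in> carrier (?R n)" using step.hyps by (intro mpoly_Var_carrier) simp
    have xB: "poly B ?x \<notin> M" using b(2) B(1) by simp
    obtain a where a: "a \<in> carrier (?R j) - M" and spec: "\<forall>\<phi> :: 'k mpoly \<Rightarrow> 'k.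
      comm_ring_morphism \<phi> \<longrightarrow> (\<forall>d \<in> carrier (?R j) \<inter> M. \<phi> d = 0) \<longrightarrow> \<phi> a \<noteq> 0 \<longrightarrow>
      (\<exists>t. (\<forall>G\<in>P.DX. poly G ?x \<in> M \<longrightarrow> poly (map_poly \<phi> G) t = 0) \<and> poly (map_poly \<phi> B) t \<noteq> 0)"
      using P.extend_specialization[OF x B(2) xB, where ?'k = 'k] by (elim bexE)
    show ?case
    proof (intro bexI[of _ a] allI impI)
      fix \<xi>
      assume \<xi>: "(\<forall>p \<in> M \<inter> carrier (?R j). mpoly_eval \<xi> p = 0) \<and> mpoly_eval \<xi> a \<noteq> 0"
      obtain t where t: "\<And>G. G \<in> P.DX \<Longrightarrow> poly G ?x \<in> M \<Longrightarrow> poly (map_poly (mpoly_eval \<xi>) G) t = 0"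
        "poly (map_poly (mpoly_eval \<xi>) B) t \<noteq> 0"
      proof -
        have "\<exists>t. (\<forall>G\<in>P.DX. poly G ?x \<in> M \<longrightarrow> poly (map_poly (mpoly_eval \<xi>) G) t = 0) \<and>
            poly (map_poly (mpoly_eval \<xi>) B) t \<noteq> 0"
          using spec[rule_format, OF mpoly_eval_hom, of \<xi>] \<xi> by blast
        thus thesis using that by blast
      qed
      let ?\<eta> = "\<xi>(j := t)"
      have eval: "mpoly_eval ?\<eta> (poly G ?x) = poly (map_poly (mpoly_eval \<xi>) G) t" if "G \<in> P.DX" for G
      proof -
        interpret \<eta>: comm_ring_morphism "mpoly_eval ?\<eta>" by (rule mpoly_eval_hom)
        interpret \<xi>: comm_ring_morphism "mpoly_eval \<xi>" by (rule mpoly_eval_hom)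
        have "map_poly (mpoly_eval ?\<eta>) G = map_poly (mpoly_eval \<xi>) G"
        proof (rule poly_eqI)
          fix i
          have "mpoly_eval ?\<eta> (Polynomial.coeff G i) = mpoly_eval \<xi> (Polynomial.coeff G i)"
            by (rule mpoly_eval_cong[OF P.DX_coeff[OF that]]) simp
          thus "Polynomial.coeff (map_poly (mpoly_eval ?\<eta>) G) i = Polynomial.coeff (map_poly (mpoly_eval \<xi>) G) i"
            by (simp add: coeff_map_poly \<eta>.hom_zero \<xi>.hom_zero)
        qed
        thus ?thesis by (simp add: \<eta>.hom_poly mpoly_eval_Var)
      qed
      show "\<exists>\<eta>. \<forall>p\<in>M. mpoly_eval \<eta> p = 0"
      proof (rule ext[of ?\<eta>])
        show "mpoly_eval ?\<eta> b \<noteq> 0" using eval[OF B(2)] t(2) B(1) by simp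
        fix p assume p: "p \<in> M" "p \<in> carrier (?R (Suc j))"
        obtain G where G: "p = poly G ?x" "\<forall>i. Polynomial.coeff G i \<in> carrier (?R j)"
          by (rule mpoly_as_poly_in_last_Var[OF p(2)])
        hence "G \<in> P.DX" by (simp add: P.DX_def)
        from eval[OF this] t(1)[OF this] p(1) G(1) show "mpoly_eval ?\<eta> p = 0" by metis
      qed
    qed (rule a)
  qed
  \<comment> \<open>Any total assignment represents the point of zero-dimensional space.\<close>
  from this[of 0] obtain b where b: "b \<in> carrier (?R 0)" "b \<notin> M" and
    ext: "\<And>\<xi>. (\<And>p. p \<in> M \<Longrightarrow> p \<in> carrier (?R 0) \<Longrightarrow> mpoly_eval \<xi> p = 0) \<Longrightarrow> mpoly_eval \<xi> b \<noteq> 0 \<Longrightarrow>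
      \<exists>\<eta>. \<forall>p\<in>M. mpoly_eval \<eta> p = 0"
    by blast
  obtain \<eta> where \<eta>: "\<And>p. p \<in> M \<Longrightarrow> mpoly_eval \<eta> p = 0"
  proof -
    have "\<exists>\<eta>. \<forall>p\<in>M. mpoly_eval \<eta> p = 0"
    proof (rule ext[of "\<lambda>_. 0"])
      obtain c where "b = mpoly_Const c" using mpoly_ring_0_Const[OF b(1)] .
      thus "mpoly_eval (\<lambda>_. 0) b \<noteq> 0"
        using b(2) ideal_mpoly_zero[OF M_ideal] by (auto simp: mpoly_eval_Const mpoly_Const_hom)
    next
      fix p assume p: "p \<in> M" "p \<in> carrier (?R 0)"
      obtain c where c: "p = mpoly_Const c" using mpoly_ring_0_Const[OF p(2)] .
      have "mpoly_Const (1 / c) * p \<in> M" by (intro ideal_mpoly_mult[OF M_ideal] mpoly_Const_carrier p)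
      hence "c = 0" using one c by (cases "c = 0") (simp_all flip: mpoly_Const_hom)
      thus "mpoly_eval (\<lambda>_. 0) p = 0" by (simp add: c mpoly_eval_Const)
    qed
    thus ?thesis using that by blast
  qed
  show ?thesis
  proof (intro bexI[of _ "restrict \<eta> {..<n}"] ballI)
    show "restrict \<eta> {..<n} \<in> affine_space n" by (simp add: affine_space_def)
    fix p assume p: "p \<in> M"
    hence "mpoly_eval (restrict \<eta> {..<n}) p = mpoly_eval \<eta> p"
      using M.a_subset by (intro mpoly_eval_cong[of p n]) auto
    with \<eta>[OF p] show "mpoly_eval (restrict \<eta> {..<n}) p = 0" by simp
  qed
qed

text \<open>
  The weak Nullstellensatz: a maximal ideal is prime and so has a zero \<open>a\<close>; it is then contained
  in the ideal of \<open>a\<close>, and maximality gives equality.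
\<close>

theorem maximalideal_mpoly_iff:
  fixes M :: "'k::alg_closed_field mpoly set"
  shows "maximalideal M (mpoly_ring n) \<longleftrightarrow> (\<exists>a\<in>affine_space n. M = point_ideal n a)"
proof
  assume max: "maximalideal M (mpoly_ring n)"
  have prime: "primeideal M (mpoly_ring n)"
    by (rule cring.maximalideal_prime[OF cring_mpoly_ring max])
  obtain a where a: "a \<in> affine_space n" "\<forall>p\<in>M. mpoly_eval a p = 0"
    using primeideal_has_zero[OF prime] by (elim bexE)
  note pt = maximalideal_point_ideal[of n a]
  note pt_ideal = maximalideal.axioms(1)[OF pt]
  have "M \<subseteq> point_ideal n a"
    using a ideal_mpoly_sub[OF maximalideal.axioms(1)[OF max]] unfolding point_ideal_eq by blast
  hence "point_ideal n a = M \<or> point_ideal n a = carrier (mpoly_ring n)"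
    by (rule maximalideal.I_maximal[OF max pt_ideal _ ideal_mpoly_sub[OF pt_ideal]])
  hence "M = point_ideal n a" using maximalideal.I_notcarr[OF pt] by metis
  with a(1) show "\<exists>a\<in>affine_space n. M = point_ideal n a" by (intro bexI[of _ a])
next
  assume "\<exists>a\<in>affine_space n. M = point_ideal n a"
  then obtain a where "M = point_ideal n a" by (elim bexE)
  thus "maximalideal M (mpoly_ring n)" by (simp only: maximalideal_point_ideal)
qed

section \<open>Ideals and their powers in a quotient ring\<close>

lemma ideal_power_0: "ideal_power R J 0 = carrier R"
  by (simp add: nat_pow_def ideals_set_def)

lemma ideal_power_Suc: "ideal_power R J (Suc q) = ideal_prod R (ideal_power R J q) J"
  by (simp add: nat_pow_def ideals_set_def)

lemma (in ring) ideal_power_is_ideal: "ideal J R \<Longrightarrow> ideal (ideal_power R J q) R"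
  by (induction q) (simp_all only: ideal_power_0 ideal_power_Suc oneideal ideal_prod_is_ideal)

lemma (in ring_hom_ring) image_ideal_prod:
  assumes J: "J \<subseteq> carrier R" and K: "K \<subseteq> carrier R"
  shows "h ` ideal_prod R J K = ideal_prod S (h ` J) (h ` K)"
proof -
  have sub: "x \<in> carrier R" if "x \<in> ideal_prod R J K" for x
    using that by induction (use J K in auto)
  show ?thesis
  proof (intro equalityI subsetI)
    fix y assume "y \<in> h ` ideal_prod R J K"
    then obtain x where "x \<in> ideal_prod R J K" "y = h x" by blast
    thus "y \<in> ideal_prod S (h ` J) (h ` K)"
    proof (induction x arbitrary: y rule: ideal_prod.induct)
      case (prod i j)
      hence "h (i \<otimes> j) = h i \<otimes>\<^bsub>S\<^esub> h j" using J K by (intro hom_mult) auto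
      thus ?case using prod by (auto intro: ideal_prod.prod)
    next
      case (sum s1 s2)
      thus ?case using ideal_prod.sum[OF sum.IH(1)[OF refl] sum.IH(2)[OF refl]] sub by simp
    qed
  next
    fix y assume "y \<in> ideal_prod S (h ` J) (h ` K)"
    thus "y \<in> h ` ideal_prod R J K"
    proof induction
      case (prod i j)
      then obtain i' j' where "i' \<in> J" "j' \<in> K" "i = h i'" "j = h j'" by blast
      moreover from this have "h (i' \<otimes> j') = h i' \<otimes>\<^bsub>S\<^esub> h j'"
        using J K by (intro hom_mult) auto
      ultimately show ?case by (metis ideal_prod.prod imageI)
    next
      case (sum s1 s2)
      then obtain x1 x2 where "x1 \<in> ideal_prod R J K" "x2 \<in> ideal_prod R J K" "s1 = h x1" "s2 = h x2" by blast
      thus ?case using sub by (intro image_eqI[of _ _ "x1 \<oplus> x2"]) (auto intro: ideal_prod.sum)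
    qed
  qed
qed

lemma (in ring_hom_ring) image_ideal_power:
  assumes surj: "h ` carrier R = carrier S" and J: "ideal J R"
  shows "h ` ideal_power R J q = ideal_power S (h ` J) q"
proof (induction q)
  case 0
  show ?case by (simp only: ideal_power_0 surj)
next
  case (Suc q)
  have "ideal_power R J q \<subseteq> carrier R" "J \<subseteq> carrier R"
    using J R.ideal_power_is_ideal[OF J] by (auto dest: ideal.Icarr)
  thus ?case by (simp only: ideal_power_Suc image_ideal_prod Suc)
qed

lemma (in ring) coset_mem_image_iff:
  assumes I: "ideal I R" and J: "J \<subseteq> carrier R" and f: "f \<in> carrier R"
  shows "I +> f \<in> (\<lambda>g. I +> g) ` J \<longleftrightarrow> f \<in> I <+> J"
proof -
  interpret I: ideal I R by fact
  have "I +> f = I +> g \<longleftrightarrow> f \<in> I +> g" if "g \<in> J" for g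
    using that J f I.a_repr_independence'[of f g] I.a_rcos_self[of f] by auto
  thus ?thesis
    by (auto simp: image_iff set_add_def' a_r_coset_def' )
qed

text \<open>
  If \<open>u + v = 1\<close> with \<open>u\<close> in \<open>I\<close> and \<open>v\<close> in a power of \<open>J\<close>, then
  \<open>(u + v * x) + v * y = 1\<close> is such a decomposition for the next power.
\<close>

lemma (in ring) comaximal_power:
  assumes I: "ideal I R" and J: "ideal J R" and x: "x \<in> I" and y: "y \<in> J" and xy: "x \<oplus> y = \<one>"
  shows "I <+> ideal_power R J q = carrier R"
proof -
  interpret I: ideal I R by fact
  interpret J: ideal J R by fact
  have x': "x \<in> carrier R" and y': "y \<in> carrier R" using x y I.Icarr J.Icarr by auto
  have "\<exists>u\<in>I. \<exists>v\<in>ideal_power R J q. u \<oplus> v = \<one>"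
  proof (induction q)
    case 0
    show ?case unfolding ideal_power_0
      using I.zero_closed by (intro bexI[of _ \<zero>] bexI[of _ \<one>]) auto
  next
    case (Suc q)
    then obtain u v where uv: "u \<in> I" "v \<in> ideal_power R J q" "u \<oplus> v = \<one>" by blast
    have c: "u \<in> carrier R" "v \<in> carrier R"
      using uv I.Icarr ideal.Icarr[OF ideal_power_is_ideal[OF J]] by auto
    have "(u \<oplus> v \<otimes> x) \<oplus> v \<otimes> y = u \<oplus> v \<otimes> (x \<oplus> y)"
      using c x' y' by (simp add: r_distr a_assoc)
    also have "\<dots> = \<one>" using c uv xy by simp
    finally have "(u \<oplus> v \<otimes> x) \<oplus> v \<otimes> y = \<one>" .
    moreover have "u \<oplus> v \<otimes> x \<in> I" using uv x c by (auto intro: I.I_l_closed)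
    moreover have "v \<otimes> y \<in> ideal_power R J (Suc q)"
      unfolding ideal_power_Suc using uv y by (intro ideal_prod.prod)
    ultimately show ?case by blast
  qed
  hence "\<one> \<in> I <+> ideal_power R J q" unfolding set_add_def' by force
  thus ?thesis
    using ideal.one_imp_carrier[OF add_ideals[OF I ideal_power_is_ideal[OF J]]] by simp
qed

text \<open>
  The correspondence between ideals of \<open>R / I\<close> and ideals of \<open>R\<close> above \<open>I\<close> reflects inclusion and
  matches the unit ideals, so it matches maximal ideals.
\<close>

lemma (in ring) max_ideals_Quot:
  assumes I: "ideal I R"
  shows "max_ideals (R Quot I) = (\<lambda>J. (\<lambda>f. I +> f) ` J) ` {J. maximalideal J R \<and> I \<subseteq> J}"
proof -
  let ?\<pi> = "\<lambda>J. (\<lambda>f. I +> f) ` J"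
  let ?A = "{J. ideal J R \<and> I \<subseteq> J}"
  let ?S = "R Quot I"
  interpret S: ring ?S by (rule ideal.quotient_is_ring[OF I])
  have bij: "bij_betw ?\<pi> ?A {K. ideal K ?S}" by (rule quot_ideal_correspondence[OF I])
  have R: "carrier R \<in> ?A" using oneideal ideal.Icarr[OF I] by blast
  have top: "?\<pi> (carrier R) = carrier ?S"
    by (auto simp: FactRing_def A_RCOSETS_def' a_r_coset_def)
  have inj: "?\<pi> J = ?\<pi> K \<longleftrightarrow> J = K" if "J \<in> ?A" "K \<in> ?A" for J K
    using inj_onD[OF bij_betw_imp_inj_on[OF bij] _ that] by blast
  have le: "?\<pi> J \<subseteq> ?\<pi> K \<longleftrightarrow> J \<subseteq> K" if J: "J \<in> ?A" and K: "K \<in> ?A" for J K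
  proof
    assume sub: "?\<pi> J \<subseteq> ?\<pi> K"
    show "J \<subseteq> K"
    proof
      fix f assume f: "f \<in> J"
      hence "f \<in> I <+> K"
        using sub J K coset_mem_image_iff[OF I, of K f] ideal.Icarr[of J R f] ideal.Icarr[of K R]
        by blast
      thus "f \<in> K" using K by (auto simp: set_add_def' dest: additive_subgroup.a_closed[OF ideal.axioms(1)])
    qed
  qed blast
  have max: "maximalideal (?\<pi> J) ?S \<longleftrightarrow> maximalideal J R" if J: "J \<in> ?A" for J
  proof
    assume m: "maximalideal J R"
    show "maximalideal (?\<pi> J) ?S"
    proof (rule maximalidealI)
      show "ideal (?\<pi> J) ?S" using bij_betw_apply[OF bij J] by simp
      show "carrier ?S \<noteq> ?\<pi> J" using inj[OF R J] top maximalideal.I_notcarr[OF m] by simp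
      fix K' assume K': "ideal K' ?S" "?\<pi> J \<subseteq> K'" "K' \<subseteq> carrier ?S"
      have "K' \<in> ?\<pi> ` ?A" using K' bij by (simp add: bij_betw_def)
      then obtain K where K: "K \<in> ?A" "K' = ?\<pi> K" by blast
      hence "J \<subseteq> K" using le[OF J] K' by simp
      hence "K = J \<or> K = carrier R"
        using K by (intro maximalideal.I_maximal[OF m]) (auto dest: ideal.Icarr)
      thus "K' = ?\<pi> J \<or> K' = carrier ?S" using K top by auto
    qed
  next
    assume m: "maximalideal (?\<pi> J) ?S"
    show "maximalideal J R"
    proof (rule maximalidealI)
      show "ideal J R" using J by simp
      show "carrier R \<noteq> J" using top maximalideal.I_notcarr[OF m] by auto
      fix K assume K: "ideal K R" "J \<subseteq> K" "K \<subseteq> carrier R"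
      hence KA: "K \<in> ?A" using J by blast
      have "ideal (?\<pi> K) ?S" using bij_betw_apply[OF bij KA] by simp
      hence "?\<pi> K = ?\<pi> J \<or> ?\<pi> K = carrier ?S"
        using K by (intro maximalideal.I_maximal[OF m]) (auto simp flip: top)
      thus "K = J \<or> K = carrier R" using inj[OF KA J] inj[OF KA R] top by simp
    qed
  qed
  show ?thesis
  proof (intro equalityI subsetI)
    fix K' assume "K' \<in> max_ideals ?S"
    hence m: "maximalideal K' ?S" by (simp add: max_ideals_def)
    have "K' \<in> ?\<pi> ` ?A" using maximalideal.axioms(1)[OF m] bij by (simp add: bij_betw_def)
    then obtain K where "K \<in> ?A" "K' = ?\<pi> K" by blast
    with m max show "K' \<in> ?\<pi> ` {J. maximalideal J R \<and> I \<subseteq> J}" by blast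
  next
    fix K' assume "K' \<in> ?\<pi> ` {J. maximalideal J R \<and> I \<subseteq> J}"
    with max show "K' \<in> max_ideals ?S"
      by (auto simp: max_ideals_def dest: maximalideal.axioms(1))
  qed
qed

section \<open>Powers of the maximal ideals of the coordinate ring\<close>

text \<open>
  Some \<open>p\<close> in \<open>I\<close> does not vanish at \<open>a\<close>; scaled to the value \<open>1\<close> at \<open>a\<close>, it differs from \<open>1\<close> by an
  element of the ideal of \<open>a\<close>.
\<close>

lemma comaximal_point_ideal_power:
  fixes I :: "'k::field mpoly set"
  assumes I: "ideal I (mpoly_ring n)" and nsub: "\<not> I \<subseteq> point_ideal n a"
  shows "I <+>\<^bsub>mpoly_ring n\<^esub> ideal_power (mpoly_ring n) (point_ideal n a) q = carrier (mpoly_ring n)"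
proof -
  interpret ev: comm_ring_morphism "mpoly_eval a" by (rule mpoly_eval_hom)
  obtain p where p: "p \<in> I" "mpoly_eval a p \<noteq> 0"
    using nsub ideal_mpoly_sub[OF I] unfolding point_ideal_eq by blast
  let ?x = "mpoly_Const (1 / mpoly_eval a p) * p"
  have x: "?x \<in> I" by (intro ideal_mpoly_mult[OF I] mpoly_Const_carrier p)
  have y: "1 - ?x \<in> point_ideal n a"
    using x ideal_mpoly_sub[OF I] p(2)
    by (auto simp: point_ideal_eq ev.hom_diff ev.hom_one ev.hom_mult mpoly_eval_Const
        intro!: mpoly_carrier_diff mpoly_carrier_one)
  have "?x + (1 - ?x) = 1" by simp
  thus ?thesis
    by (intro ring.comaximal_power[OF cring.axioms(1)[OF cring_mpoly_ring] I _ x y])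
       (simp_all only: mpoly_ring_simps maximalideal.axioms(1)[OF maximalideal_point_ideal])
qed

theorem proposition6p2:
  fixes n q :: nat and I :: "'k::alg_closed_field mpoly set"
  assumes "ideal I (mpoly_ring n)"
    and "q \<ge> 1"
  shows "quot_ideal (mpoly_ring n) (Phi_star n q I) I =
    ideals_Inter (mpoly_ring n Quot I)
      ((\<lambda>\<nn>. ideal_power (mpoly_ring n Quot I) \<nn> q) ` max_ideals (mpoly_ring n Quot I))"
proof -
  let ?R = "mpoly_ring n :: 'k mpoly ring"
  let ?S = "?R Quot I"
  let ?\<pi> = "\<lambda>f. I +>\<^bsub>?R\<^esub> f"
  note I = assms(1)
  interpret R: cring ?R by (rule cring_mpoly_ring)
  interpret pr: ring_hom_ring ?R ?S ?\<pi> by (rule ideal.rcos_ring_hom_ring[OF I])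
  have surj: "?\<pi> ` carrier ?R = carrier ?S"
    by (auto simp: FactRing_def A_RCOSETS_def' a_r_coset_def)
  let ?F = "\<lambda>a. I <+>\<^bsub>?R\<^esub> ideal_power ?R (point_ideal n a) q"
  have pt: "ideal (point_ideal n a) ?R" for a
    by (rule maximalideal.axioms(1)[OF maximalideal_point_ideal])
  have F_sub: "?F a \<subseteq> carrier ?R" for a
    by (intro ideal_mpoly_sub R.add_ideals I R.ideal_power_is_ideal pt)
  \<comment> \<open>Affine space has a point, so the intersection of the \<open>?F a\<close> stays inside the carrier.\<close>
  have "restrict (\<lambda>_. 0) {..<n} \<in> affine_space n"
    by (simp add: affine_space_def)
  hence Phi_sub: "Phi_star n q I \<subseteq> carrier ?R"
    using F_sub unfolding Phi_star_def by blast
  have max: "max_ideals ?S = (\<lambda>a. ?\<pi> ` point_ideal n a) ` {a \<in> affine_space n. I \<subseteq> point_ideal n a}"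
    unfolding R.max_ideals_Quot[OF I] maximalideal_mpoly_iff by blast
  have pow: "?\<pi> f \<in> ideal_power ?S (?\<pi> ` point_ideal n a) q \<longleftrightarrow> f \<in> ?F a"
    if "f \<in> carrier ?R" for f a
    unfolding pr.image_ideal_power[OF surj pt, symmetric]
    using that by (intro R.coset_mem_image_iff I ideal_mpoly_sub R.ideal_power_is_ideal pt)
  have mem: "?\<pi> f \<in> ideals_Inter ?S ((\<lambda>\<nn>. ideal_power ?S \<nn> q) ` max_ideals ?S) \<longleftrightarrow> f \<in> Phi_star n q I"
    if f: "f \<in> carrier ?R" for f
  proof -
    have "?\<pi> f \<in> carrier ?S" using f surj by blast
    hence "?\<pi> f \<in> ideals_Inter ?S ((\<lambda>\<nn>. ideal_power ?S \<nn> q) ` max_ideals ?S) \<longleftrightarrow>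
      (\<forall>a \<in> {a \<in> affine_space n. I \<subseteq> point_ideal n a}. f \<in> ?F a)"
      unfolding ideals_Inter_def max by (simp add: pow[OF f])
    also have "\<dots> \<longleftrightarrow> (\<forall>a \<in> affine_space n. f \<in> ?F a)"
      using comaximal_point_ideal_power[OF I] f by blast
    finally show ?thesis by (simp add: Phi_star_def)
  qed
  show ?thesis
  proof (intro equalityI subsetI)
    fix y assume "y \<in> quot_ideal ?R (Phi_star n q I) I"
    thus "y \<in> ideals_Inter ?S ((\<lambda>\<nn>. ideal_power ?S \<nn> q) ` max_ideals ?S)"
      using mem Phi_sub unfolding quot_ideal_def by blast
  next
    fix y assume y: "y \<in> ideals_Inter ?S ((\<lambda>\<nn>. ideal_power ?S \<nn> q) ` max_ideals ?S)"
    then obtain f where "f \<in> carrier ?R" "y = ?\<pi> f"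
      using surj unfolding ideals_Inter_def by blast
    with y mem show "y \<in> quot_ideal ?R (Phi_star n q I) I"
      unfolding quot_ideal_def by blast
  qed
qed

end
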